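(* There are positive constants $n_0$ and $c$ such that for all positive integers $n$, if $n\ge n_0$ then $m(n,n-1)\le c^{\sqrt{\ln n}}$.
   Context: A hypergraph is an ordered pair $(X,H)$ such that $X$ is a set and $H$ is a family of subsets of $X$; elements of $X$ are its vertices and members of $H$ are its edges (edges may have arbitrary sizes). For any two distinct vertices $u,v$ of a hypergraph $(X,H)$, the line $\overline{uv}$ is the set $\{u,v\}\cup\{p\in X:\ \exists\, T\in H \text{ with } \{u,v,p\}\subseteq T\}$. The lines of the hypergraph are all the sets $\overline{uv}$ with $u,v$ distinct vertices; the number of lines is the number of distinct such sets. For integers $n,k$, $m(n,k)$ denotes the smallest number of (distinct) lines in a hypergraph on $n$ vertices where every line consists of at most $k$ vertices. $\ln$ denotes the natural logarithm. *)

theory Defs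
  imports Complex_Main
begin

definition hypergraph :: "'a set \<times> 'a set set \<Rightarrow> bool" where
  "hypergraph G \<longleftrightarrow> snd G \<subseteq> Pow (fst G)"

definition line :: "'a set \<times> 'a set set \<Rightarrow> 'a \<Rightarrow> 'a \<Rightarrow> 'a set" where
  "line G u v = {u, v} \<union> {p \<in> fst G. \<exists>T \<in> snd G. {u, v, p} \<subseteq> T}"

definition lines :: "'a set \<times> 'a set set \<Rightarrow> 'a set set" where
  "lines G = {line G u v | u v. u \<in> fst G \<and> v \<in> fst G \<and> u \<noteq> v}"

definition admissible :: "nat \<Rightarrow> nat \<Rightarrow> 'a set \<times> 'a set set \<Rightarrow> bool" where
  "admissible n k G \<longleftrightarrow>
     hypergraph G \<and> finite (fst G) \<and> card (fst G) = n \<and> (\<forall>L \<in> lines G. card L \<le> k)"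

text \<open>Vertices are taken to be natural numbers; \<open>min_lines_le\<close> below shows that this choice of
  vertex type does not affect the minimum. When no admissible hypergraph exists (e.g. \<open>n = 2\<close>,
  \<open>k = 1\<close>) the value of \<open>min_lines n k\<close> is unspecified; \<open>min_lines_attained\<close> shows that
  this does not happen for \<open>n \<ge> 3\<close>, \<open>k = n - 1\<close>.\<close>

definition min_lines :: "nat \<Rightarrow> nat \<Rightarrow> nat" where
  "min_lines n k =
     (LEAST l. \<exists>G :: nat set \<times> nat set set. admissible n k G \<and> card (lines G) = l)"

lemma min_lines_attained:
  assumes "k \<ge> 2"
  shows "\<exists>G :: nat set \<times> nat set set. admissible n k G \<and> card (lines G) = min_lines n k"
proof -
  let ?G = "({..<n}, {}) :: nat set \<times> nat set set"
  have "card L \<le> k" if "L \<in> lines ?G" for L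
  proof -
    from that obtain u v where L: "L = {u, v}"
      by (auto simp: lines_def line_def)
    have "card L \<le> 2"
      unfolding L by (cases "u = v") auto
    with assms show ?thesis by linarith
  qed
  then have "\<exists>l. \<exists>G :: nat set \<times> nat set set. admissible n k G \<and> card (lines G) = l"
    by (intro exI[of _ "card (lines ?G)"] exI[of _ ?G]) (simp add: admissible_def hypergraph_def)
  then show ?thesis
    unfolding min_lines_def by (rule LeastI_ex)
qed

lemma min_lines_le:
  fixes G :: "'a set \<times> 'a set set"
  assumes "admissible n k G"
  shows "min_lines n k \<le> card (lines G)"
proof -
  obtain X H where G: "G = (X, H)" by (cases G)
  from assms have fin: "finite X" and H: "H \<subseteq> Pow X"
    by (auto simp: admissible_def hypergraph_def G)
  obtain f :: "'a \<Rightarrow> nat" where inj: "inj_on f X"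
    using finite_imp_inj_to_nat_seg[OF fin] by blast
  let ?G = "(f ` X, (`) f ` H)"
  have mem: "f x \<in> f ` T \<longleftrightarrow> x \<in> T" if "x \<in> X" "T \<in> H" for x T
    using inj_on_image_mem_iff[OF inj, of x T] that H by blast
  have line: "line ?G (f u) (f v) = f ` line G u v" if "u \<in> X" "v \<in> X" for u v
  proof -
    have "(\<exists>T \<in> (`) f ` H. {f u, f v, f p} \<subseteq> T) \<longleftrightarrow> (\<exists>T \<in> H. {u, v, p} \<subseteq> T)"
      if "p \<in> X" for p
    proof -
      have "{f u, f v, f p} \<subseteq> f ` T \<longleftrightarrow> {u, v, p} \<subseteq> T" if "T \<in> H" for T
        using mem[OF \<open>u \<in> X\<close> that] mem[OF \<open>v \<in> X\<close> that] mem[OF \<open>p \<in> X\<close> that] by simp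
      then show ?thesis
        by simp
    qed
    then have "{q \<in> f ` X. \<exists>T \<in> (`) f ` H. {f u, f v, q} \<subseteq> T}
        = f ` {p \<in> X. \<exists>T \<in> H. {u, v, p} \<subseteq> T}"
      unfolding Compr_image_eq by (intro arg_cong[where f = "(`) f"] Collect_cong conj_cong refl)
    then show ?thesis
      by (simp add: line_def G)
  qed
  have lines: "lines ?G = (`) f ` lines G"
  proof
    show "lines ?G \<subseteq> (`) f ` lines G"
    proof
      fix L assume "L \<in> lines ?G"
      then obtain u v where uv: "u \<in> X" "v \<in> X" "f u \<noteq> f v" "L = line ?G (f u) (f v)"
        by (auto simp: lines_def)
      then have "u \<noteq> v" "L = f ` line G u v"
        using line by auto
      with uv show "L \<in> (`) f ` lines G"
        by (auto simp: lines_def G)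
    qed
    show "(`) f ` lines G \<subseteq> lines ?G"
    proof
      fix L assume "L \<in> (`) f ` lines G"
      then obtain u v where uv: "u \<in> X" "v \<in> X" "u \<noteq> v" "L = f ` line G u v"
        by (auto simp: lines_def G)
      then have "L = line ?G (f u) (f v)" "f u \<noteq> f v"
        using line inj by (auto simp: inj_on_eq_iff)
      with uv show "L \<in> lines ?G"
        unfolding lines_def by auto
    qed
  qed
  have sub: "lines G \<subseteq> Pow X"
    by (auto simp: lines_def line_def G)
  have card: "card (lines ?G) = card (lines G)"
    unfolding lines using inj_on_image_Pow[OF inj] sub
    by (intro card_image) (rule inj_on_subset)
  have "card (f ` L) = card L" if "L \<in> lines G" for L
    using that sub by (intro card_image inj_on_subset[OF inj]) blast
  moreover have "hypergraph ?G"
    using H by (auto simp: hypergraph_def)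
  ultimately have "admissible n k ?G"
    using assms fin card_image[OF inj] by (simp add: admissible_def lines G)
  then have "\<exists>G :: nat set \<times> nat set set. admissible n k G \<and> card (lines G) = card (lines ?G)"
    by blast
  then have "min_lines n k \<le> card (lines ?G)"
    unfolding min_lines_def by (rule Least_le)
  then show ?thesis
    by (simp only: card)
qed

end

theory Submission
  imports Defs "HOL-Library.FuncSet"
begin

text \<open>
  Fix \<open>m\<close> and \<open>q\<close>. The vertices are pairs \<open>(t, x)\<close> of a type \<open>t < 2 * m\<close> and a word
  \<open>x \<in> {..<q} ^ m\<close>. Two distinct types \<open>t\<close>, \<open>t'\<close> select the coordinate \<open>s = (t + t') mod m\<close>, and
  the triples that are not edges are those of the form \<open>(t, x), (t, x'), (t', y)\<close> with
  \<open>t \<noteq> t'\<close> and \<open>x s \<noteq> x' s\<close>. The complement of the line through \<open>(t, x)\<close> and \<open>(t, x')\<close>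
  depends only on \<open>t\<close> and on the set of coordinates where \<open>x\<close> and \<open>x'\<close> differ; the complement of
  the line through \<open>(t, x)\<close> and \<open>(t', y)\<close> depends only on \<open>t\<close>, \<open>t'\<close>, \<open>x s\<close>, \<open>y s\<close>. Hence there are at
  most \<open>2 m 2\<^sup>m + (2 m q)\<^sup>2\<close> lines. The same holds on every subset of the vertices, and no
  line is universal as long as the subset contains the constant words 0 and 1 of each type.
  Taking \<open>q = 3 ^ m\<close> gives room for \<open>3 ^ (m\<^sup>2)\<close> vertices with only exponentially many lines in \<open>m\<close>.
\<close>

section \<open>Hypergraphs given by their forbidden triples\<close>

definition triples_avoiding :: "('a \<Rightarrow> 'a \<Rightarrow> 'a \<Rightarrow> bool) \<Rightarrow> 'a set \<Rightarrow> 'a set set" where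
  "triples_avoiding R X = {{u, v, p} | u v p. u \<in> X \<and> v \<in> X \<and> p \<in> X \<and> \<not> R u v p}"

text \<open>An edge has at most three vertices, so an edge containing three distinct vertices
  \<open>u\<close>, \<open>v\<close>, \<open>p\<close> is exactly that triple, and by
  \<open>swap\<close> its listing order is irrelevant to \<open>R\<close>. The case of
  \<open>p\<close> equal to \<open>u\<close> or \<open>v\<close> is settled by
  \<open>degenerate\<close>.\<close>

lemma line_triples_avoiding:
  assumes swap: "\<And>u v p. R u v p \<Longrightarrow> R v u p" "\<And>u v p. R u v p \<Longrightarrow> R u p v"
    and degenerate: "\<And>u v. \<not> R u v u"
    and uv: "u \<in> X" "v \<in> X" "u \<noteq> v"
  shows "line (X, triples_avoiding R X) u v = {p \<in> X. \<not> R u v p}"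
proof (intro equalityI subsetI)
  fix p assume p: "p \<in> line (X, triples_avoiding R X) u v"
  show "p \<in> {p \<in> X. \<not> R u v p}"
  proof (cases "p = u \<or> p = v")
    case True
    then show ?thesis
      using uv degenerate swap by blast
  next
    case False
    with p obtain a b c where abc: "{u, v, p} \<subseteq> {a, b, c}" "\<not> R a b c" and "p \<in> X"
      by (auto simp: line_def triples_avoiding_def)
    have "\<not> R u v p"
      using abc False \<open>u \<noteq> v\<close> swap by (smt (verit) insert_iff insert_subset empty_iff)
    with \<open>p \<in> X\<close> show ?thesis
      by simp
  qed
next
  fix p assume "p \<in> {p \<in> X. \<not> R u v p}"
  then show "p \<in> line (X, triples_avoiding R X) u v"
    using uv by (auto simp: line_def triples_avoiding_def)
qed

section \<open>Typed words and their forbidden triples\<close>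

type_synonym vertex = "nat \<times> (nat \<Rightarrow> nat)"

definition splits :: "nat \<Rightarrow> vertex \<Rightarrow> vertex \<Rightarrow> vertex \<Rightarrow> bool" where
  "splits m u v p \<longleftrightarrow> fst u = fst v \<and> fst p \<noteq> fst u \<and>
     snd u ((fst u + fst p) mod m) \<noteq> snd v ((fst u + fst p) mod m)"

definition nonedge :: "nat \<Rightarrow> vertex \<Rightarrow> vertex \<Rightarrow> vertex \<Rightarrow> bool" where
  "nonedge m u v p \<longleftrightarrow> splits m u v p \<or> splits m u p v \<or> splits m v p u"

lemma splits_commute: "splits m u v p \<Longrightarrow> splits m v u p"
  by (auto simp: splits_def)

lemma nonedge_swap:
  "nonedge m u v p \<Longrightarrow> nonedge m v u p"
  "nonedge m u v p \<Longrightarrow> nonedge m u p v"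
  by (auto simp: nonedge_def intro: splits_commute)

lemma not_nonedge_degenerate: "\<not> nonedge m u v u"
  by (auto simp: nonedge_def splits_def)

definition words :: "nat \<Rightarrow> nat \<Rightarrow> (nat \<Rightarrow> nat) set" where
  "words m q = {..<m} \<rightarrow>\<^sub>E {..<q}"

definition const_word :: "nat \<Rightarrow> nat \<Rightarrow> nat \<Rightarrow> nat" where
  "const_word m a = (\<lambda>i\<in>{..<m}. a)"

definition core :: "nat \<Rightarrow> vertex set" where
  "core m = {..<2 * m} \<times> const_word m ` {0, 1}"

lemma words_differ:
  assumes "x \<in> words m q" "y \<in> words m q" "x \<noteq> y"
  obtains i where "i < m" "x i \<noteq> y i"
  using assms PiE_ext[of x "{..<m}" "\<lambda>_. {..<q}" y] unfolding words_def by blast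

text \<open>There are twice as many types as coordinates so that every type \<open>t\<close> reaches every
  coordinate, including \<open>2 * t mod m\<close>, through a type different from \<open>t\<close>.\<close>

lemma other_type:
  fixes m t i :: nat
  assumes "i < m"
  obtains t' where "t' < 2 * m" "t' \<noteq> t" "(t + t') mod m = i"
proof -
  \<comment> \<open>This is \<open>i - t\<close> modulo \<open>m\<close>, arranged to avoid
    truncated subtraction. Both \<open>r\<close> and \<open>r + m\<close> lie below
    \<open>2 * m\<close>, and at least one of them differs from \<open>t\<close>.\<close>
  define r where "r = (i + (m - t mod m)) mod m"
  have "t mod m < m" "r < m"
    using assms by (auto simp: r_def)
  have "(t + r) mod m = (t mod m + (i + (m - t mod m))) mod m"
    by (simp add: r_def mod_simps)
  also have "\<dots> = (i + m) mod m"
    using \<open>t mod m < m\<close> by (simp add: algebra_simps)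
  finally have r: "(t + r) mod m = i"
    using assms by simp
  then have r': "(t + (r + m)) mod m = i"
    by (metis add.assoc mod_add_self2)
  show ?thesis
    using that[of r] that[of "r + m"] r r' \<open>r < m\<close> assms by force
qed

text \<open>The vertex off the line is found in \<open>core m\<close>. For equal types, any word
  works once its type selects a coordinate where the two words differ; for distinct types, one of
  the letters 0 and 1 differs from the letter of \<open>u\<close> at the selected
  coordinate.\<close>

lemma exists_nonedge:
  assumes X: "core m \<subseteq> X" "X \<subseteq> {..<2 * m} \<times> words m q"
    and uv: "u \<in> X" "v \<in> X" "u \<noteq> v"
  shows "\<exists>p\<in>X. nonedge m u v p"
proof -
  obtain t x t' y where u: "u = (t, x)" and v: "v = (t', y)"
    by (cases u, cases v)
  have t: "t < 2 * m" and xy: "x \<in> words m q" "y \<in> words m q"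
    using uv X u v by auto
  show ?thesis
  proof (cases "t = t'")
    case True
    with u v uv xy obtain i where i: "i < m" "x i \<noteq> y i"
      using words_differ by metis
    obtain t'' where t'': "t'' < 2 * m" "t'' \<noteq> t" "(t + t'') mod m = i"
      using other_type[OF i(1)] by blast
    have "(t'', const_word m 0) \<in> X"
      using X(1) t'' by (auto simp: core_def)
    moreover have "nonedge m u v (t'', const_word m 0)"
      using True t'' i by (simp add: nonedge_def splits_def u v)
    ultimately show ?thesis by blast
  next
    case False
    let ?s = "(t + t') mod m"
    have "?s < m"
      using t by simp
    then have "const_word m 0 ?s \<noteq> const_word m 1 ?s"
      by (simp add: const_word_def)
    then obtain a where a: "a \<in> {0, 1 :: nat}" "const_word m a ?s \<noteq> x ?s"
      by (metis insertI1 insertI2)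
    have "(t, const_word m a) \<in> X"
      using X(1) t a by (auto simp: core_def)
    moreover have "nonedge m u v (t, const_word m a)"
      using False a by (auto simp: nonedge_def splits_def u v)
    ultimately show ?thesis by blast
  qed
qed

section \<open>Counting the lines\<close>

definition same_type_line :: "nat \<Rightarrow> vertex set \<Rightarrow> nat \<times> nat set \<Rightarrow> vertex set" where
  "same_type_line m X = (\<lambda>(t, D). {p \<in> X. \<not> (fst p \<noteq> t \<and> (t + fst p) mod m \<in> D)})"

definition cross_type_line ::
    "nat \<Rightarrow> vertex set \<Rightarrow> (nat \<times> nat) \<times> (nat \<times> nat) \<Rightarrow> vertex set" where
  "cross_type_line m X = (\<lambda>((t, t'), (a, b)).
     {p \<in> X. \<not> (fst p = t \<and> snd p ((t + t') mod m) \<noteq> a \<or> fst p = t' \<and> snd p ((t + t') mod m) \<noteq> b)})"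

lemma nonedge_line_cases:
  assumes X: "X \<subseteq> {..<2 * m} \<times> words m q"
    and uv: "u \<in> X" "v \<in> X"
  shows "{p \<in> X. \<not> nonedge m u v p} \<in> same_type_line m X ` ({..<2 * m} \<times> Pow {..<m})
    \<union> cross_type_line m X ` (({..<2 * m} \<times> {..<2 * m}) \<times> ({..<q} \<times> {..<q}))"
proof -
  obtain t x t' y where u: "u = (t, x)" and v: "v = (t', y)"
    by (cases u, cases v)
  have t: "t < 2 * m" "t' < 2 * m" and xy: "x \<in> words m q" "y \<in> words m q"
    using uv X u v by auto
  show ?thesis
  proof (cases "t = t'")
    case True
    have "{p \<in> X. \<not> nonedge m u v p} = same_type_line m X (t, {i \<in> {..<m}. x i \<noteq> y i})"
      using True t by (auto simp: nonedge_def splits_def same_type_line_def u v)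
    then show ?thesis
      using t by blast
  next
    case False
    let ?s = "(t + t') mod m"
    have "?s < m"
      using t by simp
    then have "x ?s < q" "y ?s < q"
      using xy by (auto simp: words_def)
    moreover have "{p \<in> X. \<not> nonedge m u v p} = cross_type_line m X ((t, t'), (x ?s, y ?s))"
      using False by (auto simp: nonedge_def splits_def cross_type_line_def u v add.commute)
    ultimately show ?thesis
      using t by blast
  qed
qed

lemma card_core: "m > 0 \<Longrightarrow> card (core m) = 4 * m"
proof -
  assume "m > 0"
  then have "const_word m 0 0 \<noteq> const_word m 1 0"
    by (simp add: const_word_def)
  then have "const_word m 0 \<noteq> const_word m 1"
    by metis
  then show ?thesis
    by (simp add: core_def card_cartesian_product)
qed

lemma min_lines_upper_bound:
  assumes m: "m > 0" and q: "q \<ge> 2" and n: "4 * m \<le> n" "n \<le> 2 * m * q ^ m"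
  shows "min_lines n (n - 1) \<le> 2 * m * 2 ^ m + (2 * m * q)\<^sup>2"
proof -
  have "finite (words m q)" "card (words m q) = q ^ m"
    by (auto simp: words_def card_PiE intro: finite_PiE)
  then have full: "finite ({..<2 * m} \<times> words m q)" "card ({..<2 * m} \<times> words m q) = 2 * m * q ^ m"
    by (simp_all add: card_cartesian_product)
  \<comment> \<open>Here \<open>q \<ge> 2\<close> makes both letters 0 and 1 available.\<close>
  have "core m \<subseteq> {..<2 * m} \<times> words m q"
    using q by (auto simp: core_def const_word_def words_def split: if_splits)
  then obtain X where X: "core m \<subseteq> X" "X \<subseteq> {..<2 * m} \<times> words m q" "card X = n"
    using exists_subset_between[of "core m" n] n full card_core[OF m] by metis
  have "finite X"
    using X full finite_subset by blast
  define G where "G = (X, triples_avoiding (nonedge m) X)"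
  have line: "line G u v = {p \<in> X. \<not> nonedge m u v p}" if "u \<in> X" "v \<in> X" "u \<noteq> v" for u v
    unfolding G_def using that
    by (intro line_triples_avoiding) (auto intro: nonedge_swap simp: not_nonedge_degenerate)
  have "card L \<le> n - 1" if "L \<in> lines G" for L
  proof -
    from that obtain u v where uv: "u \<in> X" "v \<in> X" "u \<noteq> v" and "L = line G u v"
      by (auto simp: lines_def G_def)
    then have "L = {p \<in> X. \<not> nonedge m u v p}"
      using line by simp
    moreover obtain p where "p \<in> X" "nonedge m u v p"
      using exists_nonedge[OF X(1,2) uv] by blast
    ultimately have "L \<subset> X"
      by blast
    then have "card L < n"
      using psubset_card_mono[OF \<open>finite X\<close>] X(3) by blast
    then show ?thesis by simp
  qed
  then have "admissible n (n - 1) G"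
    using \<open>finite X\<close> X(3) by (auto simp: admissible_def hypergraph_def G_def triples_avoiding_def)
  then have "min_lines n (n - 1) \<le> card (lines G)"
    by (rule min_lines_le)
  also have "\<dots> \<le> card (same_type_line m X ` ({..<2 * m} \<times> Pow {..<m})
      \<union> cross_type_line m X ` (({..<2 * m} \<times> {..<2 * m}) \<times> ({..<q} \<times> {..<q})))"
  proof (rule card_mono)
    show "lines G \<subseteq> same_type_line m X ` ({..<2 * m} \<times> Pow {..<m})
      \<union> cross_type_line m X ` (({..<2 * m} \<times> {..<2 * m}) \<times> ({..<q} \<times> {..<q}))"
    proof
      fix L assume "L \<in> lines G"
      then obtain u v where uv: "u \<in> X" "v \<in> X" "u \<noteq> v" and "L = line G u v"
        by (auto simp: lines_def G_def)
      then show "L \<in> same_type_line m X ` ({..<2 * m} \<times> Pow {..<m})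
      \<union> cross_type_line m X ` (({..<2 * m} \<times> {..<2 * m}) \<times> ({..<q} \<times> {..<q}))"
        using nonedge_line_cases[OF X(2) uv(1,2)] line by simp
    qed
  qed auto
  also have "\<dots> \<le> card ({..<2 * m} \<times> Pow {..<m})
      + card (({..<2 * m} \<times> {..<2 * m}) \<times> ({..<q} \<times> {..<q}))"
    by (intro order_trans[OF card_Un_le] add_mono card_image_le) auto
  also have "\<dots> = 2 * m * 2 ^ m + (2 * m * q)\<^sup>2"
    by (simp add: card_cartesian_product card_Pow power2_eq_square)
  finally show ?thesis .
qed

section \<open>Choice of parameters\<close>

lemma line_count_exponential:
  fixes m :: nat
  shows "2 * m * 2 ^ m + (2 * m * 3 ^ m)\<^sup>2 \<le> 40 ^ m"
proof (cases "m = 0")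
  case False
  have "2 * m \<le> 2 ^ m"
  proof -
    have "m - 1 < 2 ^ (m - 1)"
      by (rule less_exp)
    then have "2 * m \<le> 2 * 2 ^ (m - 1)"
      by linarith
    also have "\<dots> = 2 ^ m"
      using False by (simp flip: power_Suc)
    finally show ?thesis .
  qed
  then have "2 * m * 2 ^ m + (2 * m * 3 ^ m)\<^sup>2 \<le> 2 ^ m * 2 ^ m + (2 ^ m * 3 ^ m)\<^sup>2"
    by (intro add_mono mult_right_mono power_mono) auto
  also have "\<dots> = 4 ^ m + 36 ^ m"
    by (simp flip: power_mult_distrib add: power2_eq_square)
  \<comment> \<open>For \<open>m = 0\<close> this would read 2 \<le> 1, hence the case
    split.\<close>
  also have "\<dots> \<le> (4 + 36) ^ m"
    using False[unfolded neq0_conv]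
  proof (induction m rule: nat_induct_non_zero)
    case (Suc k)
    then show ?case by simp
  qed simp
  finally show ?thesis by simp
qed simp

theorem theorem3:
  "\<exists>n0 c :: real. n0 > 0 \<and> c > 0 \<and>
     (\<forall>n :: nat. n > 0 \<longrightarrow> real n \<ge> n0 \<longrightarrow>
        real (min_lines n (n - 1)) \<le> c powr sqrt (ln (real n)))"
\<comment> \<open>The bound 64 serves to give \<open>8 * r \<le> n\<close>, which leaves room for
  the core; 1600 is the square of 40, since \<open>m \<le> 2 * r\<close>.\<close>
proof (rule exI[of _ 64], rule exI[of _ 1600], intro conjI allI impI)
  fix n :: nat assume "n > 0" and n: "real n \<ge> 64"
  define r where "r = sqrt (ln (real n))"
  define m where "m = nat \<lceil>r\<rceil>"
  have "exp 1 \<le> real n"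
    using exp_le n by linarith
  then have "ln (real n) \<ge> 1"
    using n by (subst ln_ge_iff) auto
  then have r: "r \<ge> 1" "r\<^sup>2 = ln (real n)"
    by (auto simp: r_def)
  have m: "m > 0" "r \<le> real m" "real m \<le> 2 * r"
    using r(1) unfolding m_def by linarith+
  have "ln (real n) \<le> real n"
    using n ln_le_minus_one[of "real n"] by linarith
  have "(8 * r)\<^sup>2 = 64 * ln (real n)"
    by (simp add: power_mult_distrib r)
  also have "\<dots> \<le> (real n)\<^sup>2"
    unfolding power2_eq_square using n \<open>ln (real n) \<le> real n\<close> \<open>ln (real n) \<ge> 1\<close> by (intro mult_mono) auto
  finally have "8 * r \<le> real n"
    by (rule power2_le_imp_le) simp
  with m have lower: "4 * m \<le> n"
    by linarith
  have "real n = exp (r\<^sup>2)"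
    using n by (simp add: r)
  also have "\<dots> \<le> exp (real m * real m)"
    using m(2) r(1) unfolding exp_le_cancel_iff power2_eq_square by (intro mult_mono) auto
  also have "\<dots> = exp 1 ^ (m * m)"
    by (simp flip: exp_of_nat_mult)
  \<comment> \<open>As e \<le> 3, the alphabet size \<open>q = 3 ^ m\<close> suffices for
    \<open>n\<close> vertices.\<close>
  also have "\<dots> \<le> 3 ^ (m * m)"
    by (intro power_mono exp_le) simp
  finally have "real n \<le> real (3 ^ (m * m))"
    by simp
  then have "n \<le> (3 ^ m) ^ m"
    unfolding of_nat_le_iff by (simp add: power_mult)
  also have "\<dots> \<le> 2 * m * (3 ^ m) ^ m"
    using m by simp
  finally have upper: "n \<le> 2 * m * (3 ^ m) ^ m" .
  have "(2::nat) \<le> 3 ^ m"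
    using m self_le_power[of "3::nat" m] by linarith
  then have "min_lines n (n - 1) \<le> 40 ^ m"
    using min_lines_upper_bound[OF m(1) _ lower upper] line_count_exponential[of m] by linarith
  then have "real (min_lines n (n - 1)) \<le> 40 ^ m"
    using of_nat_mono by fastforce
  also have "\<dots> = 40 powr real m"
    by (simp add: powr_realpow)
  also have "\<dots> \<le> 40 powr (2 * r)"
    using m by (intro powr_mono) auto
  also have "\<dots> = (40 powr 2) powr r"
    by (simp only: powr_powr)
  also have "\<dots> = 1600 powr r"
    by simp
  finally show "real (min_lines n (n - 1)) \<le> 1600 powr sqrt (ln (real n))"
    by (simp add: r_def)
qed auto

end
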